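(* For every integer $k\ge 2$, $\operatorname{osat}_{\mathcal{CC}}(k,3)=\operatorname{osat}_{\mathcal{CC}}(3,k)=k-1$. For every integer $k\ge 4$, $\operatorname{osat}_{\mathcal{CC}}(k,4)=\operatorname{osat}_{\mathcal{CC}}(4,k)=2k-2$. For all integers $k\ge 5$ and $l\ge 5$, \[2k+2l-12\le \operatorname{osat}_{\mathcal{CC}}(k,l)\le 2k+2l-10.\]
   Context: Point sets are finite sets in the plane in general position (no three collinear, no two with the same $x$-coordinate). A set of $k$ points is a $k$-cup (resp. $k$-cap) if it lies on the graph of a convex (resp. concave) function; equivalently, listing the points by increasing $x$-coordinate, the slopes of consecutive segments are increasing (resp. decreasing). A point set $P$ is $(k,l)$-semisaturated if for every point $q\notin P$ with $P\cup\{q\}$ in general position, $P\cup\{q\}$ contains a $k$-cup or an $l$-cap containing $q$ (i.e. a new $k$-cup or $l$-cap). $\operatorname{osat}_{\mathcal{CC}}(k,l)$ is the minimum size of a $(k,l)$-semisaturated point set. *)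

theory Defs
  imports "HOL-Analysis.Analysis" "HOL-Library.Extended_Nat"
begin

definition general_position :: "(real \<times> real) set \<Rightarrow> bool" where
  "general_position P \<longleftrightarrow>
     inj_on fst P \<and>
     (\<forall>a\<in>P. \<forall>b\<in>P. \<forall>c\<in>P. a \<noteq> b \<and> b \<noteq> c \<and> a \<noteq> c \<longrightarrow> \<not> collinear {a, b, c})"

definition point_set :: "(real \<times> real) set \<Rightarrow> bool" where
  "point_set P \<longleftrightarrow> finite P \<and> general_position P"

text \<open>Convexity of \<open>f\<close> need not be strict: in general position no three points of a cup
  or cap are collinear, so the slopes of consecutive segments are strictly monotone.\<close>

definition cup :: "nat \<Rightarrow> (real \<times> real) set \<Rightarrow> bool" where
  "cup k S \<longleftrightarrow> finite S \<and> card S = k \<and>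
     (\<exists>f :: real \<Rightarrow> real. convex_on UNIV f \<and> (\<forall>p\<in>S. f (fst p) = snd p))"

definition cap :: "nat \<Rightarrow> (real \<times> real) set \<Rightarrow> bool" where
  "cap l S \<longleftrightarrow> finite S \<and> card S = l \<and>
     (\<exists>f :: real \<Rightarrow> real. concave_on UNIV f \<and> (\<forall>p\<in>S. f (fst p) = snd p))"

definition semisaturated :: "nat \<Rightarrow> nat \<Rightarrow> (real \<times> real) set \<Rightarrow> bool" where
  "semisaturated k l P \<longleftrightarrow> point_set P \<and>
     (\<forall>q. q \<notin> P \<and> general_position (P \<union> {q}) \<longrightarrow>
        (\<exists>S \<subseteq> P \<union> {q}. q \<in> S \<and> (cup k S \<or> cap l S)))"

text \<open>The minimum is taken in \<^typ>\<open>enat\<close>, so that it is \<open>\<infinity>\<close> if there is no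
  semisaturated point set; a finite value, or a finite upper bound, includes existence.\<close>

definition osat :: "nat \<Rightarrow> nat \<Rightarrow> enat" where
  "osat k l = (INF P \<in> {P. semisaturated k l P}. enat (card P))"

lemma osat_eq_enat_iff:
  "osat k l = enat n \<longleftrightarrow>
     (\<exists>P. semisaturated k l P \<and> card P = n) \<and> (\<forall>P. semisaturated k l P \<longrightarrow> n \<le> card P)"
  (is "?L \<longleftrightarrow> ?R")
proof
  let ?A = "(\<lambda>P. enat (card P)) ` {P. semisaturated k l P}"
  assume L: ?L
  then have Inf: "Inf ?A = enat n"
    by (simp add: osat_def)
  have "?A \<noteq> {}"
    using Inf by (metis Inf_empty enat.distinct(1) top_enat_def)
  then have "Inf ?A \<in> ?A"
    by (metis (no_types, lifting) wellorder_InfI ex_in_conv)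
  then have ex: "\<exists>P. semisaturated k l P \<and> card P = n"
    using Inf by auto
  have "n \<le> card P" if "semisaturated k l P" for P
  proof -
    have "Inf ?A \<le> enat (card P)"
      by (rule Inf_lower) (use that in auto)
    with Inf show ?thesis by simp
  qed
  with ex show ?R by blast
next
  assume ?R
  then obtain P where "semisaturated k l P" "card P = n"
      and "\<And>Q. semisaturated k l Q \<Longrightarrow> n \<le> card Q"
    by blast
  then show ?L
    unfolding osat_def by (intro antisym INF_greatest) (auto intro: INF_lower2)
qed

end

(* A set is a cup iff all its triples, sorted by abscissa, have nonnegative orientation (turn).
   Reflecting the plane in the x-axis exchanges cups and caps, so osat is symmetric.

   For l = 3, a new point high on the far right lies in no 3-cap, and k - 1 points on a parabola are
   semisaturated.  Lower bound for k, l >= 4: a new point q placed very high on a vertical line lies in no l-cap, and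
   in a k-cup only as an endpoint, so each vertical line missing P has a (k-1)-cup of P
   entirely on one side.  Taking the leftmost possible right endpoint p of a (k-1)-cup, P contains
   (k-1)-cups A, B with A weakly left of p and B weakly right of it; dually there are (l-1)-caps
   C, D separated at a point r.  A cup and a cap share at most two points, and one of the
   intersections of A with D and of B with C is empty if p and r differ, which leaves
   (2k-3) + (2l-3) - 6 points.  For l = 4 the set P cannot be just the union of A and B, since
   then the 3-cap C or D would lie in a cup.

   Upper bound: six explicit points are (4,4)-semisaturated, and adding two high points, one on either
   side of P, increases k (or, after reflection, l) by one. *)

theory Submission
  imports Defs
begin

section \<open>Orientation of triples and general position\<close>

definition turn :: "real \<times> real \<Rightarrow> real \<times> real \<Rightarrow> real \<times> real \<Rightarrow> real" where
  "turn a b c = (fst b - fst a) * (snd c - snd a) - (snd b - snd a) * (fst c - fst a)"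

lemma turn_swap: "turn a c b = - turn a b c"
  by (simp add: turn_def algebra_simps)

lemma turn_rotate: "turn c a b = turn a b c"
  by (simp add: turn_def algebra_simps)

lemma turn_perms:
  "turn b a c = - turn a b c" "turn b c a = turn a b c" "turn c b a = - turn a b c"
  by (simp_all add: turn_def algebra_simps)

text \<open>Multiplied by the positive \<open>fst c - fst b\<close>, each conclusion becomes a
  combination of the two given orientations with positive coefficients.\<close>

lemma turn_trans:
  assumes "fst a < fst b" "fst b < fst c" "fst c < fst d"
    and "0 \<le> turn a b c" "0 \<le> turn b c d"
  shows "0 \<le> turn a b d" "0 \<le> turn a c d"
proof -
  have "(fst c - fst b) * turn a b d
      = (fst d - fst b) * turn a b c + (fst b - fst a) * turn b c d"
    by (simp add: turn_def algebra_simps)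
  moreover have "\<dots> \<ge> 0"
    using assms by (intro add_nonneg_nonneg mult_nonneg_nonneg) auto
  ultimately have "0 \<le> (fst c - fst b) * turn a b d" by argo
  then show "0 \<le> turn a b d"
    using assms(2) by (simp add: zero_le_mult_iff)
  have "(fst c - fst b) * turn a c d
      = (fst c - fst a) * turn b c d + (fst d - fst c) * turn a b c"
    by (simp add: turn_def algebra_simps)
  moreover have "\<dots> \<ge> 0"
    using assms by (intro add_nonneg_nonneg mult_nonneg_nonneg) auto
  ultimately have "0 \<le> (fst c - fst b) * turn a c d" by argo
  then show "0 \<le> turn a c d"
    using assms(2) by (simp add: zero_le_mult_iff)
qed

lemma collinear_iff_turn:
  assumes "fst a \<noteq> fst b"
  shows "collinear {a, b, c} \<longleftrightarrow> turn a b c = 0"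
proof -
  have "collinear {a, b, c} \<longleftrightarrow> collinear {0, b - a, c - a}"
    using collinear_3[of b a c] by (simp add: NO_MATCH_def insert_commute)
  also have "\<dots> \<longleftrightarrow> c - a = 0 \<or> (\<exists>t. c - a = t *\<^sub>R (b - a))"
    using assms by (auto simp: collinear_lemma)
  also have "\<dots> \<longleftrightarrow> (\<exists>t. c - a = t *\<^sub>R (b - a))"
    by (metis scale_zero_left)
  also have "\<dots> \<longleftrightarrow> turn a b c = 0"
  proof
    assume "\<exists>t. c - a = t *\<^sub>R (b - a)"
    then obtain t where "c - a = t *\<^sub>R (b - a)" by blast
    then have "fst c - fst a = t * (fst b - fst a)" "snd c - snd a = t * (snd b - snd a)"
      by (metis fst_diff fst_scaleR real_scaleR_def, metis snd_diff snd_scaleR real_scaleR_def)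
    then show "turn a b c = 0" by (simp add: turn_def)
  next
    assume "turn a b c = 0"
    then have "snd c - snd a = (fst c - fst a) * (snd b - snd a) / (fst b - fst a)"
      using assms by (subst nonzero_eq_divide_eq) (auto simp: turn_def algebra_simps)
    then have "c - a = ((fst c - fst a) / (fst b - fst a)) *\<^sub>R (b - a)"
      using assms by (simp add: prod_eq_iff)
    then show "\<exists>t. c - a = t *\<^sub>R (b - a)" by blast
  qed
  finally show ?thesis .
qed

text \<open>Permuting three points changes their orientation at most in sign, so only triples sorted
  by abscissa have to be tested.\<close>

lemma general_position_iff:
  "general_position P \<longleftrightarrow> inj_on fst P \<and>
     (\<forall>a\<in>P. \<forall>b\<in>P. \<forall>c\<in>P. fst a < fst b \<longrightarrow> fst b < fst c \<longrightarrow> turn a b c \<noteq> 0)"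
  (is "_ \<longleftrightarrow> inj_on fst P \<and> ?R")
proof (cases "inj_on fst P")
  case inj: True
  have "collinear {a, b, c} \<longleftrightarrow> turn a b c = 0" if "a \<in> P" "b \<in> P" "a \<noteq> b" for a b c
    using that inj_onD[OF inj] by (intro collinear_iff_turn) blast
  then have "general_position P \<longleftrightarrow>
      (\<forall>a\<in>P. \<forall>b\<in>P. \<forall>c\<in>P. a \<noteq> b \<and> b \<noteq> c \<and> a \<noteq> c \<longrightarrow> turn a b c \<noteq> 0)"
    using inj unfolding general_position_def by blast
  also have "\<dots> \<longleftrightarrow> ?R"
  proof
    assume ?R
    then have R: "turn x y z \<noteq> 0"
      if "x \<in> P" "y \<in> P" "z \<in> P" "fst x < fst y" "fst y < fst z" for x y z
      using that by blast
    show "\<forall>a\<in>P. \<forall>b\<in>P. \<forall>c\<in>P. a \<noteq> b \<and> b \<noteq> c \<and> a \<noteq> c \<longrightarrow> turn a b c \<noteq> 0"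
    proof (intro ballI impI)
      fix a b c assume abc: "a \<in> P" "b \<in> P" "c \<in> P" "a \<noteq> b \<and> b \<noteq> c \<and> a \<noteq> c"
      then have "fst a \<noteq> fst b" "fst b \<noteq> fst c" "fst a \<noteq> fst c"
        using inj by (auto dest: inj_onD)
      then consider "fst a < fst b" "fst b < fst c" | "fst a < fst c" "fst c < fst b"
        | "fst b < fst a" "fst a < fst c" | "fst b < fst c" "fst c < fst a"
        | "fst c < fst a" "fst a < fst b" | "fst c < fst b" "fst b < fst a"
        by linarith
      then show "turn a b c \<noteq> 0"
        using R[of a b c] R[of a c b] R[of b a c] R[of b c a] R[of c a b] R[of c b a]
          abc turn_swap[of a c b] turn_rotate[of c a b] turn_perms[where a = a and b = b and c = c]
        by cases simp_all
    qed
  qed auto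
  finally show ?thesis using inj by simp
qed (simp add: general_position_def)

lemma general_position_subset: "general_position Q \<Longrightarrow> P \<subseteq> Q \<Longrightarrow> general_position P"
  unfolding general_position_def by (meson inj_on_subset subsetD)

section \<open>Cups as convex chains\<close>

definition convex_chain :: "(real \<times> real) set \<Rightarrow> bool" where
  "convex_chain S \<longleftrightarrow> inj_on fst S \<and>
     (\<forall>a\<in>S. \<forall>b\<in>S. \<forall>c\<in>S. fst a < fst b \<longrightarrow> fst b < fst c \<longrightarrow> 0 \<le> turn a b c)"

lemma convex_chainD:
  "convex_chain S \<Longrightarrow> a \<in> S \<Longrightarrow> b \<in> S \<Longrightarrow> c \<in> S \<Longrightarrow> fst a < fst b \<Longrightarrow> fst b < fst c
    \<Longrightarrow> 0 \<le> turn a b c"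
  by (simp add: convex_chain_def)

lemma convex_chain_subset: "convex_chain S \<Longrightarrow> T \<subseteq> S \<Longrightarrow> convex_chain T"
  unfolding convex_chain_def by (meson inj_on_subset subsetD)

text \<open>Serves to choose a slope between those of the segments arriving at a point and those
  leaving it; one family is empty at an end of the chain.\<close>

lemma finite_separation:
  fixes A B :: "real set"
  assumes "finite A" "finite B" "\<And>a b. a \<in> A \<Longrightarrow> b \<in> B \<Longrightarrow> a \<le> b"
  obtains m where "\<And>a. a \<in> A \<Longrightarrow> a \<le> m" "\<And>b. b \<in> B \<Longrightarrow> m \<le> b"
proof (cases "A = {}")
  case True
  then show ?thesis
  proof (cases "B = {}")
    case False
    then show ?thesis using that[of "Min B"] True assms by auto
  qed (use that in auto)
next
  case False
  then show ?thesis using that[of "Max A"] assms by auto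
qed

lemma convex_on_Max:
  fixes f :: "'i \<Rightarrow> real \<Rightarrow> real"
  assumes "finite I" "I \<noteq> {}" "\<And>i. i \<in> I \<Longrightarrow> convex_on UNIV (f i)"
  shows "convex_on UNIV (\<lambda>x. Max ((\<lambda>i. f i x) ` I))"
proof (rule convex_onI)
  fix t x y :: real assume t: "0 < t" "t < 1"
  let ?M = "\<lambda>x. Max ((\<lambda>i. f i x) ` I)"
  have "f i ((1 - t) *\<^sub>R x + t *\<^sub>R y) \<le> (1 - t) * ?M x + t * ?M y" if "i \<in> I" for i
  proof -
    have "f i ((1 - t) *\<^sub>R x + t *\<^sub>R y) \<le> (1 - t) * f i x + t * f i y"
      using convex_onD[OF assms(3)[OF that]] t by auto
    also have "\<dots> \<le> (1 - t) * ?M x + t * ?M y"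
      using t that assms(1) by (intro add_mono mult_left_mono) auto
    finally show ?thesis .
  qed
  then show "?M ((1 - t) *\<^sub>R x + t *\<^sub>R y) \<le> (1 - t) * ?M x + t * ?M y"
    using assms by auto
qed simp

lemma turn_slope:
  assumes "fst a < fst b" "fst b < fst c"
  shows "0 \<le> turn a b c \<longleftrightarrow>
    (snd b - snd a) / (fst b - fst a) \<le> (snd c - snd b) / (fst c - fst b)"
  using assms by (simp add: turn_def divide_simps) (simp add: algebra_simps)

text \<open>By \<open>turn_slope\<close>, a segment arriving at \<open>p\<close> from the left is at
  most as steep as any segment leaving to the right. A line through \<open>p\<close> whose slope
  separates the two families stays weakly below \<open>S\<close>.\<close>

lemma supporting_slope:
  assumes "convex_chain S" "finite S" "p \<in> S"
  obtains m where "\<And>r. r \<in> S \<Longrightarrow> snd p + m * (fst r - fst p) \<le> snd r"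
proof -
  let ?slope = "\<lambda>a b. (snd b - snd a) / (fst b - fst a)"
  obtain m where m: "\<And>s. s \<in> (\<lambda>r. ?slope r p) ` {r\<in>S. fst r < fst p} \<Longrightarrow> s \<le> m"
      "\<And>s. s \<in> ?slope p ` {r\<in>S. fst p < fst r} \<Longrightarrow> m \<le> s"
  proof (rule finite_separation)
    fix s t assume "s \<in> (\<lambda>r. ?slope r p) ` {r\<in>S. fst r < fst p}"
      "t \<in> ?slope p ` {r\<in>S. fst p < fst r}"
    then obtain a b where ab: "a \<in> S" "b \<in> S" "fst a < fst p" "fst p < fst b"
      and st: "s = ?slope a p" "t = ?slope p b"
      by blast
    show "s \<le> t"
      unfolding st using ab turn_slope convex_chainD[OF assms(1) ab(1) assms(3) ab(2)] by blast
  qed (use assms in auto)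
  have "snd p + m * (fst r - fst p) \<le> snd r" if r: "r \<in> S" for r
  proof -
    consider "r = p" | "fst r < fst p" | "fst p < fst r"
      using assms r unfolding convex_chain_def by (metis inj_onD linorder_neqE)
    then show ?thesis
    proof cases
      case 2
      then have "?slope r p \<le> m" using m(1) r by blast
      then show ?thesis using 2 by (simp add: field_simps)
    next
      case 3
      then have "m \<le> ?slope p r" using m(2) r by blast
      then show ?thesis using 3 by (simp add: field_simps)
    qed simp
  qed
  then show ?thesis using that by blast
qed

text \<open>The convex function is the maximum of one supporting line per point: each line meets its
  own point and stays weakly below the others. Conversely, chord slopes of a convex function
  increase weakly, which is why \<open>convex_chain\<close> uses
  \<open>0 \<le> turn a b c\<close>.\<close>

lemma convex_chain_iff:
  assumes "finite S"
  shows "convex_chain S \<longleftrightarrow> (\<exists>f :: real \<Rightarrow> real. convex_on UNIV f \<and> (\<forall>p\<in>S. f (fst p) = snd p))"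
proof
  assume S: "convex_chain S"
  show "\<exists>f :: real \<Rightarrow> real. convex_on UNIV f \<and> (\<forall>p\<in>S. f (fst p) = snd p)"
  proof (cases "S = {}")
    case True
    then show ?thesis by (auto intro: convex_on_const)
  next
    case False
    have "\<forall>p\<in>S. \<exists>m. \<forall>r\<in>S. snd p + m * (fst r - fst p) \<le> snd r"
      using supporting_slope[OF S assms] by meson
    then obtain m where m: "\<And>p r. p \<in> S \<Longrightarrow> r \<in> S \<Longrightarrow> snd p + m p * (fst r - fst p) \<le> snd r"
      by metis
    let ?L = "\<lambda>p x. snd p + m p * (x - fst p)"
    have "convex_on UNIV (?L p)" for p
      by (rule convex_onI) (auto simp: algebra_simps)
    then have "convex_on UNIV (\<lambda>x. Max ((\<lambda>p. ?L p x) ` S))"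
      using assms False by (intro convex_on_Max)
    moreover have "Max ((\<lambda>p. ?L p (fst r)) ` S) = snd r" if "r \<in> S" for r
      using m that assms by (intro Max_eqI) (auto intro!: image_eqI[of _ _ r])
    ultimately show ?thesis by blast
  qed
next
  assume "\<exists>f :: real \<Rightarrow> real. convex_on UNIV f \<and> (\<forall>p\<in>S. f (fst p) = snd p)"
  then obtain f :: "real \<Rightarrow> real" where f: "convex_on UNIV f" "\<And>p. p \<in> S \<Longrightarrow> snd p = f (fst p)"
    by metis
  have "inj_on fst S"
    using f(2) by (metis inj_onI prod_eq_iff)
  moreover have "0 \<le> turn a b c" if "a \<in> S" "b \<in> S" "c \<in> S" "fst a < fst b" "fst b < fst c" for a b c
  proof -
    have "(f (fst a) - f (fst b)) / (fst a - fst b) \<le> (f (fst b) - f (fst c)) / (fst b - fst c)"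
      using convex_on_slope_le[OF f(1), of "fst a" "fst c" "fst b"] that by auto
    then show ?thesis
      using that f(2) by (simp add: turn_slope) (smt (verit) minus_divide_divide)
  qed
  ultimately show "convex_chain S" by (simp add: convex_chain_def)
qed

lemma cup_iff: "cup k S \<longleftrightarrow> finite S \<and> card S = k \<and> convex_chain S"
  using convex_chain_iff unfolding cup_def by blast

section \<open>Reflection in the x-axis and the symmetry of osat\<close>

definition flip :: "real \<times> real \<Rightarrow> real \<times> real" where
  "flip p = (fst p, - snd p)"

lemma fst_flip [simp]: "fst (flip p) = fst p"
  and snd_flip [simp]: "snd (flip p) = - snd p"
  and flip_flip [simp]: "flip (flip p) = p"
  by (simp_all add: flip_def)

lemma flip_flip_image [simp]: "flip ` flip ` S = S"
  by (simp add: image_image)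

lemma inj_flip: "inj_on flip S"
  by (metis flip_flip inj_onI)

lemma card_flip [simp]: "card (flip ` S) = card S"
  by (simp add: card_image inj_flip)

lemma turn_flip [simp]: "turn (flip a) (flip b) (flip c) = - turn a b c"
  by (simp add: turn_def algebra_simps)

lemma inj_on_fst_flip [simp]: "inj_on fst (flip ` S) \<longleftrightarrow> inj_on fst S"
  by (simp add: comp_inj_on_iff[OF inj_flip] o_def)

text \<open>Negating the function exchanges convex and concave, so questions about caps become
  questions about cups of the reflected set.\<close>

lemma cap_iff: "cap l S \<longleftrightarrow> cup l (flip ` S)"
proof -
  have "(\<exists>f :: real \<Rightarrow> real. concave_on UNIV f \<and> (\<forall>p\<in>S. f (fst p) = snd p)) \<longleftrightarrow>
      (\<exists>f :: real \<Rightarrow> real. convex_on UNIV f \<and> (\<forall>p\<in>flip ` S. f (fst p) = snd p))"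
    (is "?L \<longleftrightarrow> ?R")
  proof
    assume ?L
    then obtain f :: "real \<Rightarrow> real" where "concave_on UNIV f" "\<forall>p\<in>S. f (fst p) = snd p" by blast
    then show ?R by (intro exI[of _ "\<lambda>x. - f x"]) (auto simp: concave_on_def)
  next
    assume ?R
    then obtain f :: "real \<Rightarrow> real" where "convex_on UNIV f" "\<forall>p\<in>flip ` S. f (fst p) = snd p" by blast
    then show ?L by (intro exI[of _ "\<lambda>x. - f x"]) (auto simp: concave_on_def)
  qed
  then show ?thesis
    using finite_image_iff[OF inj_flip] by (simp add: cap_def cup_def)
qed

lemma cup_iff_cap_flip: "cup l S \<longleftrightarrow> cap l (flip ` S)"
  by (simp add: cap_iff)

lemma convex_chain_flipD:
  "convex_chain (flip ` S) \<Longrightarrow> a \<in> S \<Longrightarrow> b \<in> S \<Longrightarrow> c \<in> S \<Longrightarrow> fst a < fst b \<Longrightarrow> fst b < fst c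
    \<Longrightarrow> turn a b c \<le> 0"
  using convex_chainD[of "flip ` S" "flip a" "flip b" "flip c"] by simp

lemma general_position_flip: "general_position (flip ` P) \<longleftrightarrow> general_position P"
  by (simp add: general_position_iff)

text \<open>The new point is reflected back, and the cup or cap that \<open>P\<close> supplies for
  it is reflected forward, which exchanges the two kinds.\<close>

lemma semisaturated_flip:
  assumes "semisaturated k l P"
  shows "semisaturated l k (flip ` P)"
proof -
  have "\<exists>S \<subseteq> flip ` P \<union> {q}. q \<in> S \<and> (cup l S \<or> cap k S)"
    if q: "q \<notin> flip ` P" "general_position (flip ` P \<union> {q})" for q
  proof -
    have "flip ` P \<union> {q} = flip ` (P \<union> {flip q})" by simp
    then have "general_position (P \<union> {flip q})"
      using q(2) general_position_flip by metis
    moreover have "flip q \<notin> P" using q(1) by (metis flip_flip imageI)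
    ultimately obtain S where S: "S \<subseteq> P \<union> {flip q}" "flip q \<in> S" "cup k S \<or> cap l S"
      using assms unfolding semisaturated_def by blast
    have "flip ` S \<subseteq> flip ` P \<union> {q}" "q \<in> flip ` S"
      using image_mono[OF S(1), of flip] S(2) by (auto intro: image_eqI[of _ _ "flip q"])
    then show ?thesis
      using S(3) cap_iff cup_iff_cap_flip by metis
  qed
  then show ?thesis
    using assms by (simp add: semisaturated_def point_set_def general_position_flip)
qed

lemma semisaturated_flip_iff: "semisaturated l k (flip ` P) \<longleftrightarrow> semisaturated k l P"
  using semisaturated_flip[of k l P] semisaturated_flip[of l k "flip ` P"] by auto

lemma osat_commute: "osat k l = osat l k"
proof -
  have "{P. semisaturated l k P} = (`) flip ` {P. semisaturated k l P}"
    by (auto simp: semisaturated_flip_iff intro!: image_eqI[of _ _ "flip ` _"])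
  then show ?thesis
    by (simp add: osat_def image_image)
qed

section \<open>High points, and simple facts on cups and caps\<close>

lemma general_position_insert:
  assumes "general_position P" "fst q \<notin> fst ` P"
    and turn: "\<And>a b. a \<in> P \<Longrightarrow> b \<in> P \<Longrightarrow> fst a < fst b \<Longrightarrow> turn a b q \<noteq> 0"
  shows "general_position (insert q P)"
proof -
  have "turn q a b \<noteq> 0" "turn a q b \<noteq> 0" if "a \<in> P" "b \<in> P" "fst a < fst b" for a b
    using turn[OF that] turn_rotate[of q a b] turn_swap[of a q b] by simp_all
  then show ?thesis
    using assms unfolding general_position_iff inj_on_insert by auto
qed

text \<open>For \<open>fst a < fst b\<close>, a positive \<open>turn a b q\<close> says that
  \<open>q\<close> is above the line through \<open>a\<close> and \<open>b\<close>, wherever its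
  abscissa lies. Only finitely many lines have to be exceeded at \<open>x\<close>, so every large
  enough ordinate works.\<close>

lemma exists_high_point:
  assumes "finite P" "general_position P" "x \<notin> fst ` P"
  obtains q where "fst q = x" "general_position (insert q P)"
    and "\<And>a b. a \<in> P \<Longrightarrow> b \<in> P \<Longrightarrow> fst a < fst b \<Longrightarrow> 0 < turn a b q"
proof -
  have "\<forall>\<^sub>F y in at_top. fst a < fst b \<longrightarrow> 0 < turn a b (x, y)" for a b :: "real \<times> real"
  proof (rule eventually_mono[OF eventually_gt_at_top])
    fix y assume "snd a + (snd b - snd a) * (x - fst a) / (fst b - fst a) < y"
    then show "fst a < fst b \<longrightarrow> 0 < turn a b (x, y)"
      by (auto simp: turn_def field_simps)
  qed
  then have "\<forall>\<^sub>F y in at_top. \<forall>a\<in>P. \<forall>b\<in>P. fst a < fst b \<longrightarrow> 0 < turn a b (x, y)"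
    by (intro eventually_ball_finite[OF assms(1)] ballI) blast
  then obtain y where y: "\<And>a b. a \<in> P \<Longrightarrow> b \<in> P \<Longrightarrow> fst a < fst b \<Longrightarrow> 0 < turn a b (x, y)"
    unfolding eventually_at_top_linorder by blast
  show ?thesis
  proof
    show "general_position (insert (x, y) P)"
    proof (rule general_position_insert[OF assms(2)])
      show "turn a b (x, y) \<noteq> 0" if "a \<in> P" "b \<in> P" "fst a < fst b" for a b
        using y[OF that] by simp
    qed (use assms(3) in simp)
  qed (use y in auto)
qed

lemma three_in_order:
  fixes f :: "'a \<Rightarrow> 'b :: linorder"
  assumes "3 \<le> card S" "inj_on f S"
  obtains a b c where "a \<in> S" "b \<in> S" "c \<in> S" "f a < f b" "f b < f c"
proof -
  obtain T where "T \<subseteq> S" "card T = 3"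
    using obtain_subset_with_card_n[OF assms(1)] by auto
  then obtain a b c where "a \<in> S" "b \<in> S" "c \<in> S" "a \<noteq> b" "b \<noteq> c" "a \<noteq> c"
    by (auto simp: card_3_iff)
  moreover from this have "f a < f b \<or> f b < f a" "f b < f c \<or> f c < f b" "f a < f c \<or> f c < f a"
    using inj_onD[OF assms(2)] by (meson linorder_neqE)+
  ultimately show ?thesis
    using that[of a b c] that[of a c b] that[of b a c] that[of b c a] that[of c a b] that[of c b a]
    by blast
qed

lemma general_position_turn_nz:
  "general_position P \<Longrightarrow> a \<in> P \<Longrightarrow> b \<in> P \<Longrightarrow> c \<in> P \<Longrightarrow> fst a < fst b \<Longrightarrow> fst b < fst c
    \<Longrightarrow> turn a b c \<noteq> 0"
  by (auto simp: general_position_iff)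

text \<open>Three common points in sorted order would turn both weakly left and weakly right, hence
  be collinear.\<close>

lemma cup_cap_Int_card:
  assumes "general_position P" "S \<subseteq> P" "convex_chain S" "convex_chain (flip ` T)"
  shows "card (S \<inter> T) \<le> 2"
proof (rule ccontr)
  assume "\<not> card (S \<inter> T) \<le> 2"
  then have "3 \<le> card (S \<inter> T)" by simp
  moreover have "inj_on fst (S \<inter> T)"
    using assms(3) unfolding convex_chain_def by (auto intro: inj_on_subset)
  ultimately obtain a b c where abc: "a \<in> S \<inter> T" "b \<in> S \<inter> T" "c \<in> S \<inter> T"
      "fst a < fst b" "fst b < fst c"
    by (rule three_in_order)
  then have "turn a b c = 0"
    using convex_chainD[OF assms(3), of a b c] convex_chain_flipD[OF assms(4), of a b c] by simp
  then show False
    using general_position_turn_nz[OF assms(1)] abc assms(2) by blast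
qed

text \<open>At least three points other than \<open>q\<close> are distributed over two sides, so one
  side receives two of them.\<close>

lemma two_on_one_side:
  fixes S :: "(real \<times> real) set"
  assumes "finite S" "q \<in> S" "inj_on fst S" "4 \<le> card S"
  obtains a b where "a \<in> S" "b \<in> S" "fst a < fst b" "fst b < fst q"
  | a b where "a \<in> S" "b \<in> S" "fst q < fst a" "fst a < fst b"
proof -
  let ?L = "{s\<in>S. fst s < fst q}" and ?R = "{s\<in>S. fst q < fst s}"
  have "s = q \<or> fst s < fst q \<or> fst q < fst s" if "s \<in> S" for s
    using assms(2,3) that by (metis inj_onD linorder_neqE)
  then have "S \<subseteq> insert q (?L \<union> ?R)" by blast
  then have "card S \<le> card (insert q (?L \<union> ?R))"
    using assms(1) by (intro card_mono) auto
  also have "\<dots> \<le> Suc (card ?L + card ?R)"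
    using assms(1) card_Un_le[of ?L ?R] by (simp add: card_insert_if)
  finally have "2 \<le> card ?L \<or> 2 \<le> card ?R"
    using assms(4) by linarith
  then consider "\<not> card ?L \<le> Suc 0" | "\<not> card ?R \<le> Suc 0" by linarith
  then show ?thesis
  proof cases
    case 1
    then obtain a b where ab: "a \<in> ?L" "b \<in> ?L" "a \<noteq> b"
      using assms(1) by (auto simp: card_le_Suc0_iff_eq)
    then have "fst a \<noteq> fst b" using assms(3) by (auto dest: inj_onD)
    then show ?thesis using ab that(1)[of a b] that(1)[of b a] by (simp add: neq_iff) blast
  next
    case 2
    then obtain a b where ab: "a \<in> ?R" "b \<in> ?R" "a \<noteq> b"
      using assms(1) by (auto simp: card_le_Suc0_iff_eq)
    then have "fst a \<noteq> fst b" using assms(3) by (auto dest: inj_onD)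
    then show ?thesis using ab that(2)[of a b] that(2)[of b a] by (simp add: neq_iff) blast
  qed
qed

section \<open>Lower bound for k and l at least 4\<close>

lemma one_sided_cup:
  assumes sat: "semisaturated k l P" and "4 \<le> l" and x: "x \<notin> fst ` P"
  obtains T where "T \<subseteq> P" "cup (k - 1) T" "(\<forall>t\<in>T. fst t < x) \<or> (\<forall>t\<in>T. x < fst t)"
proof -
  have P: "finite P" "general_position P"
    using sat by (auto simp: semisaturated_def point_set_def)
  obtain q where q: "fst q = x" "general_position (insert q P)"
    and turn: "\<And>a b. a \<in> P \<Longrightarrow> b \<in> P \<Longrightarrow> fst a < fst b \<Longrightarrow> 0 < turn a b q"
    using exists_high_point[OF P x] by blast
  have "q \<notin> P" using q(1) x by blast
  then have "\<exists>S \<subseteq> P \<union> {q}. q \<in> S \<and> (cup k S \<or> cap l S)"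
    using sat q(2) unfolding semisaturated_def by (metis Un_insert_right sup_bot_right)
  then obtain S where S: "S \<subseteq> insert q P" "q \<in> S" "cup k S \<or> cap l S" by auto
  have finS: "finite S" using S(1) P(1) finite_subset by blast
  have injS: "inj_on fst S"
    using q(2) S(1) unfolding general_position_def by (meson inj_on_subset)
  \<comment> \<open>Two points of \<open>P\<close> on the same side of \<open>q\<close> span a line
    below \<open>q\<close>; together with \<open>q\<close> they turn strictly left, which a cap does
    not allow.\<close>
  have "\<not> cap l S"
  proof
    assume "cap l S"
    then have chain: "convex_chain (flip ` S)" and "4 \<le> card S"
      using assms(2) by (auto simp: cap_iff cup_iff)
    from finS S(2) injS \<open>4 \<le> card S\<close> show False
    proof (cases rule: two_on_one_side)
      case (1 a b)
      then have "a \<in> P" "b \<in> P" using S(1) by auto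
      then show False
        using turn[of a b] convex_chain_flipD[OF chain, of a b q] 1 S(2) by simp
    next
      case (2 a b)
      then have "a \<in> P" "b \<in> P" using S(1) by auto
      then show False
        using turn[of a b] convex_chain_flipD[OF chain, of q a b] 2 S(2) turn_rotate[of q a b]
        by simp
    qed
  qed
  then have cup: "card S = k" "convex_chain S" using S(3) by (auto simp: cup_iff)
  have sub: "S - {q} \<subseteq> P" using S(1) by blast
  \<comment> \<open>Otherwise \<open>q\<close> would be an inner point of the cup, hence weakly
    below the segment from \<open>a\<close> to \<open>b\<close>, although it lies above that
    line.\<close>
  have "\<not> (fst a < x \<and> x < fst b)" if "a \<in> S - {q}" "b \<in> S - {q}" for a b
  proof
    assume ab: "fst a < x \<and> x < fst b"
    moreover have "a \<in> P" "b \<in> P" using sub that by auto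
    ultimately have "0 < turn a b q" using turn[of a b] by simp
    then show False
      using convex_chainD[OF cup(2), of a q b] that S(2) ab q(1) turn_swap[of a q b] by simp
  qed
  moreover have "fst a < x \<or> x < fst a" if "a \<in> S - {q}" for a
    using x sub that by (metis imageI linorder_neqE subsetD)
  ultimately have "(\<forall>t\<in>S - {q}. fst t < x) \<or> (\<forall>t\<in>S - {q}. x < fst t)"
    by blast
  moreover have "cup (k - 1) (S - {q})"
    using cup finS S(2) by (auto simp: cup_iff intro: convex_chain_subset)
  ultimately show ?thesis using that sub by blast
qed

text \<open>Gives a vertical line so close to the left of a point that no other point falls between.
  In the proof, \<open>x - 1\<close> covers the case that nothing lies further left.\<close>

lemma exists_just_left:
  fixes X :: "real set"
  assumes "finite X"
  obtains z where "z < x" "\<And>a. a \<in> X \<Longrightarrow> a < x \<Longrightarrow> a < z"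
proof -
  have "Max (insert (x - 1) {a\<in>X. a < x}) < x" using assms by auto
  then obtain z where z: "Max (insert (x - 1) {a\<in>X. a < x}) < z" "z < x"
    using dense by blast
  then have "a < z" if "a \<in> X" "a < x" for a
    using assms that by (simp add: Max_less_iff)
  then show ?thesis using that z(2) by blast
qed

lemma exists_right:
  fixes P :: "(real \<times> real) set"
  assumes "finite P"
  obtains x where "\<And>a. a \<in> P \<Longrightarrow> fst a < x"
proof -
  have "fst a < Max (insert 0 (fst ` P)) + 1" if "a \<in> P" for a
    using assms that by (intro le_less_trans[OF Max_ge less_add_one]) auto
  then show ?thesis using that by blast
qed

lemma exists_left:
  fixes P :: "(real \<times> real) set"
  assumes "finite P"
  obtains x where "\<And>a. a \<in> P \<Longrightarrow> x < fst a"
proof -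
  have "Min (insert 0 (fst ` P)) \<le> fst a" if "a \<in> P" for a
    using assms that by (intro Min_le) auto
  then have "Min (insert 0 (fst ` P)) - 1 < fst a" if "a \<in> P" for a
    using that by fastforce
  then show ?thesis using that by blast
qed

lemma split_cups:
  assumes sat: "semisaturated k l P" and "2 \<le> k" "4 \<le> l"
  obtains p A B where "p \<in> P" "A \<subseteq> P" "B \<subseteq> P" "cup (k - 1) A" "cup (k - 1) B"
    "\<forall>a\<in>A. fst a \<le> fst p" "\<forall>b\<in>B. fst p \<le> fst b"
proof -
  have P: "finite P" using sat by (auto simp: semisaturated_def point_set_def)
  \<comment> \<open>\<open>2 \<le> k\<close> makes these cups nonempty, so that each has a rightmost
    point.\<close>
  have ne: "T \<noteq> {}" if "cup (k - 1) T" for T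
    using that assms(2) by (auto simp: cup_iff)
  have endpoint: "\<exists>p\<in>T. \<forall>a\<in>T. fst a \<le> fst p" if "cup (k - 1) T" for T
  proof -
    have "finite (fst ` T)" "fst ` T \<noteq> {}" using ne[OF that] that by (auto simp: cup_iff)
    then show ?thesis using Max_in[of "fst ` T"] Max_ge[of "fst ` T"] by fastforce
  qed
  define X where "X = {p\<in>P. \<exists>A\<subseteq>P. cup (k - 1) A \<and> (\<forall>a\<in>A. fst a \<le> fst p)}"
  \<comment> \<open>A vertical line to the right of \<open>P\<close> yields some
    \<open>(k - 1)\<close>-cup, whose rightmost point belongs to \<open>X\<close>.\<close>
  have "X \<noteq> {}"
  proof -
    obtain x where x: "\<And>a. a \<in> P \<Longrightarrow> fst a < x"
      using exists_right[OF P] by blast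
    then have "x \<notin> fst ` P" by blast
    then obtain T where T: "T \<subseteq> P" "cup (k - 1) T" "(\<forall>t\<in>T. fst t < x) \<or> (\<forall>t\<in>T. x < fst t)"
      by (rule one_sided_cup[OF sat assms(3)])
    then show ?thesis using endpoint[OF T(2)] unfolding X_def by blast
  qed
  moreover have "finite X" using P by (simp add: X_def)
  ultimately obtain p where p: "p \<in> X" "\<And>r. r \<in> X \<Longrightarrow> fst p \<le> fst r"
    using ex_is_arg_min_if_finite[of X fst] unfolding is_arg_min_linorder by metis
  from p(1) obtain A where A: "p \<in> P" "A \<subseteq> P" "cup (k - 1) A" "\<And>a. a \<in> A \<Longrightarrow> fst a \<le> fst p"
    by (auto simp: X_def)
  \<comment> \<open>A cup to the left of \<open>z\<close> would have its rightmost point in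
    \<open>X\<close> and left of \<open>p\<close>, against the choice of \<open>p\<close>. So the
    line at \<open>z\<close> has a cup on its right, and no point of \<open>P\<close> lies between
    \<open>z\<close> and \<open>p\<close>.\<close>
  obtain z where z: "z < fst p" "\<And>a. a \<in> fst ` P \<Longrightarrow> a < fst p \<Longrightarrow> a < z"
    using exists_just_left[OF finite_imageI[OF P]] by metis
  then have "z \<notin> fst ` P" by auto
  then obtain T where T: "T \<subseteq> P" "cup (k - 1) T" "(\<forall>t\<in>T. fst t < z) \<or> (\<forall>t\<in>T. z < fst t)"
    by (rule one_sided_cup[OF sat assms(3)])
  have "\<not> (\<forall>t\<in>T. fst t < z)"
  proof
    assume "\<forall>t\<in>T. fst t < z"
    moreover obtain r where r: "r \<in> T" "\<forall>a\<in>T. fst a \<le> fst r" using endpoint[OF T(2)] by blast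
    then have "r \<in> X" using T by (auto simp: X_def)
    ultimately show False using p(2)[of r] z(1) r(1) by fastforce
  qed
  then have "fst p \<le> fst t" if "t \<in> T" for t
    using T(1,3) z(2) that by (meson image_eqI not_less order_less_asym subsetD)
  then show ?thesis using that A T(1,2) by blast
qed

text \<open>A common point has abscissa \<open>x\<close>, and distinct points have distinct
  abscissae, so at most one point is counted twice.\<close>

lemma card_Un_split:
  assumes "finite A" "finite B" "inj_on fst (A \<union> B)"
    and "\<forall>a\<in>A. fst a \<le> (x :: real)" "\<forall>b\<in>B. x \<le> fst b"
  shows "card A + card B \<le> card (A \<union> B) + 1"
proof -
  have "card (A \<inter> B) \<le> Suc 0"
  proof (subst card_le_Suc0_iff_eq)
    show "\<forall>a\<in>A \<inter> B. \<forall>b\<in>A \<inter> B. a = b"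
      using assms(3-5) by (metis Int_iff UnI1 inj_onD order_antisym)
  qed (use assms in auto)
  then show ?thesis using card_Un_Int[OF assms(1,2)] by simp
qed

lemma semisaturated_card_ge:
  assumes sat: "semisaturated k l P" and kl: "4 \<le> k" "4 \<le> l"
  shows "2 * k + 2 * l - 12 \<le> card P" and "l = 4 \<Longrightarrow> 2 * k - 2 \<le> card P"
proof -
  have P: "finite P" "general_position P" "inj_on fst P"
    using sat by (auto simp: semisaturated_def point_set_def general_position_def)
  have ge2: "2 \<le> k" "2 \<le> l" using kl by simp_all
  obtain p A B where AB: "p \<in> P" "A \<subseteq> P" "B \<subseteq> P" "cup (k - 1) A" "cup (k - 1) B"
    "\<forall>a\<in>A. fst a \<le> fst p" "\<forall>b\<in>B. fst p \<le> fst b"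
    by (rule split_cups[OF sat ge2(1) kl(2)])
  \<comment> \<open>In the reflected set, \<open>split_cups\<close> finds what become the two
    \<open>(l - 1)\<close>-caps of \<open>P\<close> after reflecting back.\<close>
  obtain r' C' D' where CD': "r' \<in> flip ` P" "C' \<subseteq> flip ` P" "D' \<subseteq> flip ` P"
    "cup (l - 1) C'" "cup (l - 1) D'"
    "\<forall>c\<in>C'. fst c \<le> fst r'" "\<forall>d\<in>D'. fst r' \<le> fst d"
    by (rule split_cups[OF semisaturated_flip[OF sat] ge2(2) kl(1)])
  define r C D where "r = flip r'" and "C = flip ` C'" and "D = flip ` D'"
  have CD: "r \<in> P" "C \<subseteq> P" "D \<subseteq> P" "cup (l - 1) (flip ` C)" "cup (l - 1) (flip ` D)"
    "\<forall>c\<in>C. fst c \<le> fst r" "\<forall>d\<in>D. fst r \<le> fst d"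
    using CD' by (auto simp: r_def C_def D_def)
  have fin: "finite A" "finite B" "finite C" "finite D"
    using AB CD P(1) finite_subset by blast+
  have card: "card A = k - 1" "card B = k - 1" "card C = l - 1" "card D = l - 1"
    using AB CD by (auto simp: cup_iff)
  have chain: "convex_chain A" "convex_chain B" "convex_chain (flip ` C)" "convex_chain (flip ` D)"
    using AB CD by (auto simp: cup_iff)
  have injAB: "inj_on fst (A \<union> B)" and injCD: "inj_on fst (C \<union> D)"
    using P(3) AB CD by (auto intro: inj_on_subset)
  have cAB: "2 * k - 3 \<le> card (A \<union> B)"
    using card_Un_split[OF fin(1,2) injAB AB(6,7)] card kl by simp
  have cCD: "2 * l - 3 \<le> card (C \<union> D)"
    using card_Un_split[OF fin(3,4) injCD CD(6,7)] card kl by simp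
  have meet: "card (A \<inter> C) \<le> 2" "card (A \<inter> D) \<le> 2" "card (B \<inter> C) \<le> 2" "card (B \<inter> D) \<le> 2"
    using cup_cap_Int_card[OF P(2)] AB CD chain by blast+
  have le: "card (X \<union> Y \<union> Z) \<le> 6" if "card X \<le> 2" "card Y \<le> 2" "card Z \<le> 2"
    for X Y Z :: "(real \<times> real) set"
    using card_Un_le[of X Y] card_Un_le[of "X \<union> Y" Z] that by linarith
  have "card ((A \<union> B) \<inter> (C \<union> D)) \<le> 6"
  proof -
    \<comment> \<open>\<open>A\<close> ends at \<open>p\<close> at the latest and \<open>D\<close>
      starts at \<open>r\<close> at the earliest, so they are disjoint if \<open>p\<close> is left
      of \<open>r\<close>; in the opposite order \<open>B\<close> and \<open>C\<close> are disjoint.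
      Three intersections of at most two points remain.\<close>
    consider "fst p < fst r" | "fst r < fst p" | "fst p = fst r" by linarith
    then show ?thesis
    proof cases
      case 1
      then have "A \<inter> D = {}" using AB(6) CD(7) by force
      then have "(A \<union> B) \<inter> (C \<union> D) = A \<inter> C \<union> B \<inter> C \<union> B \<inter> D" by blast
      then show ?thesis using le meet by simp
    next
      case 2
      then have "B \<inter> C = {}" using AB(7) CD(6) by force
      then have "(A \<union> B) \<inter> (C \<union> D) = A \<inter> C \<union> A \<inter> D \<union> B \<inter> D" by blast
      then show ?thesis using le meet by simp
    next
      \<comment> \<open>Here \<open>p\<close> and \<open>r\<close> coincide. The intersections of
        \<open>A\<close> with \<open>D\<close> and of \<open>B\<close> with \<open>C\<close> contain
        at most \<open>p\<close>, so the bound is 2 + 2 + 1.\<close>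
      case 3
      have p: "x = p" if "x \<in> P" "fst x = fst p" for x
        using that AB(1) P(3) by (meson inj_onD)
      have "x = p" if "x \<in> A \<inter> D" for x
        using that AB(2,6) CD(7) 3 by (intro p) force+
      then have "A \<inter> D \<subseteq> {p}" by blast
      moreover have "x = p" if "x \<in> B \<inter> C" for x
        using that AB(3,7) CD(6) 3 by (intro p) force+
      then have "B \<inter> C \<subseteq> {p}" by blast
      ultimately have "(A \<union> B) \<inter> (C \<union> D) \<subseteq> A \<inter> C \<union> B \<inter> D \<union> {p}" by blast
      then have "card ((A \<union> B) \<inter> (C \<union> D)) \<le> card (A \<inter> C \<union> B \<inter> D \<union> {p})"
        using fin by (intro card_mono) auto
      then show ?thesis using le[of "A \<inter> C" "B \<inter> D" "{p}"] meet by simp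
    qed
  qed
  moreover have "card (A \<union> B) + card (C \<union> D) = card (A \<union> B \<union> (C \<union> D)) + card ((A \<union> B) \<inter> (C \<union> D))"
    using fin by (intro card_Un_Int) auto
  moreover have "card (A \<union> B \<union> (C \<union> D)) \<le> card P"
    using AB CD P(1) by (intro card_mono) auto
  ultimately show "2 * k + 2 * l - 12 \<le> card P"
    using cAB cCD by linarith
  show "2 * k - 2 \<le> card P" if "l = 4"
  proof (rule ccontr)
    assume "\<not> 2 * k - 2 \<le> card P"
    \<comment> \<open>\<open>P\<close> has at most the \<open>2 * k - 3\<close> points guaranteed
      for the union of \<open>A\<close> and \<open>B\<close>, so it equals that union. Disjoint cups
      would have \<open>2 * k - 2\<close> points, so \<open>A\<close> and \<open>B\<close> meet,
      necessarily in \<open>p\<close>.\<close>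
    then have "card P \<le> card (A \<union> B)" using cAB by linarith
    then have "A \<union> B = P" using AB P(1) by (intro card_subset_eq) (auto intro: antisym card_mono)
    have "A \<inter> B \<noteq> {}"
    proof
      assume "A \<inter> B = {}"
      then have "card (A \<union> B) = 2 * (k - 1)" using card fin by (simp add: card_Un_disjoint)
      then show False
        using \<open>A \<union> B = P\<close> \<open>\<not> 2 * k - 2 \<le> card P\<close> by simp
    qed
    then obtain s where s: "s \<in> A" "s \<in> B" by blast
    then have "fst s = fst p" using AB(6,7) by (meson order_antisym)
    then have p: "p \<in> A" "p \<in> B" using s AB(1,2) P(3) by (metis inj_onD subsetD)+
    \<comment> \<open>A cap of three points does not fit into a cup. But if \<open>p\<close> is
      weakly left of \<open>r\<close>, then \<open>D\<close> is weakly right of \<open>p\<close>,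
      where \<open>P\<close> has only points of \<open>B\<close>; otherwise \<open>C\<close> lies in
      \<open>A\<close> in the same way.\<close>
    have "\<not> D \<subseteq> B" "\<not> C \<subseteq> A"
      using meet card that by (auto simp: Int_absorb1)
    moreover have "D \<subseteq> B" if "fst p \<le> fst r"
    proof
      fix d assume d: "d \<in> D"
      then have "fst p \<le> fst d" using CD(7) that by force
      then have "d = p" if "d \<in> A" using AB(1,2,6) P(3) that by (meson inj_onD order_antisym subsetD)
      then show "d \<in> B" using d p CD(3) \<open>A \<union> B = P\<close> by blast
    qed
    moreover have "C \<subseteq> A" if "fst r \<le> fst p"
    proof
      fix d assume d: "d \<in> C"
      then have "fst d \<le> fst p" using CD(6) that by force
      then have "d = p" if "d \<in> B" using AB(1,3,7) P(3) that by (meson inj_onD order_antisym subsetD)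
      then show "d \<in> A" using d p CD(2) \<open>A \<union> B = P\<close> by blast
    qed
    ultimately show False by linarith
  qed
qed

section \<open>Upper bound: lengthening cups by two new points\<close>

lemma convex_chain_insert_left:
  assumes S: "convex_chain S" and u: "\<And>s. s \<in> S \<Longrightarrow> fst u < fst s"
    and turn: "\<And>a b. a \<in> S - {q} \<Longrightarrow> b \<in> S - {q} \<Longrightarrow> fst a < fst b \<Longrightarrow> 0 \<le> turn u a b"
    and ab: "q \<in> S" "a \<in> S" "b \<in> S" "fst a < fst b" "fst b < fst q"
  shows "convex_chain (insert u S)"
proof -
  \<comment> \<open>Nothing is assumed about \<open>u\<close> together with \<open>q\<close>. A
    second point \<open>d\<close> left of \<open>q\<close> helps: the left turns \<open>u\<close>,
    \<open>c\<close>, \<open>d\<close> and \<open>c\<close>, \<open>d\<close>, \<open>q\<close>, or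
    those with \<open>c\<close> and \<open>d\<close> exchanged, combine by
    \<open>turn_trans\<close>.\<close>
  have to_q: "0 \<le> turn u c q" if c: "c \<in> S" "fst c < fst q" for c
  proof -
    obtain d where d: "d \<in> S" "fst d < fst q" "fst d \<noteq> fst c"
      using ab by (metis order_less_trans order_less_irrefl)
    have ne: "c \<noteq> q" "d \<noteq> q" using c d by auto
    from d consider "fst c < fst d" | "fst d < fst c" by linarith
    then show ?thesis
    proof cases
      case 1
      have "0 \<le> turn u c d" using turn[of c d] c d ne 1 by blast
      moreover have "0 \<le> turn c d q" using convex_chainD[OF S] c d ab(1) 1 by blast
      ultimately show ?thesis using turn_trans(1)[of u c d q] u c d 1 by blast
    next
      case 2
      have "0 \<le> turn u d c" using turn[of d c] c d ne 2 by blast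
      moreover have "0 \<le> turn d c q" using convex_chainD[OF S] c d ab(1) 2 by blast
      ultimately show ?thesis using turn_trans(2)[of u d c q] u c d 2 by blast
    qed
  qed
  have from_u: "0 \<le> turn u c d" if c: "c \<in> S" "d \<in> S" "fst c < fst d" for c d
  proof -
    consider "c = q" | "d = q" | "c \<in> S - {q}" "d \<in> S - {q}" using c by blast
    then show ?thesis
    proof cases
      \<comment> \<open>The point \<open>b\<close> left of \<open>q\<close> is the bridge: the
        triples \<open>u\<close>, \<open>b\<close>, \<open>q\<close> and \<open>b\<close>,
        \<open>q\<close>, \<open>d\<close> combine.\<close>
      case 1
      have "0 \<le> turn u b q" using to_q ab by blast
      moreover have "0 \<le> turn b q d" using convex_chainD[OF S] c ab 1 by blast
      ultimately show ?thesis using turn_trans(2)[of u b q d] u c ab 1 by blast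
    next
      case 2
      then show ?thesis using to_q c by blast
    qed (use turn c in blast)
  qed
  have "0 \<le> turn a b c"
    if "a \<in> insert u S" "b \<in> insert u S" "c \<in> insert u S" "fst a < fst b" "fst b < fst c" for a b c
  proof -
    have "b \<noteq> u" "c \<noteq> u" using that u[of a] by auto
    then show ?thesis
      using that from_u[of b c] convex_chainD[OF S, of a b c] by (cases "a = u") auto
  qed
  moreover have "inj_on fst (insert u S)"
    using S u by (force simp: convex_chain_def)
  ultimately show ?thesis by (simp add: convex_chain_def)
qed

text \<open>Reflection in the y-axis. Unlike \<open>flip\<close> it maps cups to cups, and it
  carries insertion on the left to insertion on the right.\<close>

definition mirror :: "real \<times> real \<Rightarrow> real \<times> real" where
  "mirror p = (- fst p, snd p)"

lemma fst_mirror [simp]: "fst (mirror p) = - fst p"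
  and snd_mirror [simp]: "snd (mirror p) = snd p"
  and mirror_mirror [simp]: "mirror (mirror p) = p"
  by (simp_all add: mirror_def)

lemma turn_mirror: "turn (mirror a) (mirror b) (mirror c) = turn c b a"
  by (simp add: turn_def algebra_simps)

lemma inj_mirror: "inj_on mirror S"
  by (metis mirror_mirror inj_onI)

lemma convex_chain_mirror:
  assumes "convex_chain S"
  shows "convex_chain (mirror ` S)"
proof -
  have "inj_on fst (mirror ` S)"
    using assms unfolding convex_chain_def comp_inj_on_iff[OF inj_mirror]
    by (simp add: inj_on_def)
  then show ?thesis
    using assms unfolding convex_chain_def by (simp add: turn_mirror)
qed

lemma convex_chain_insert_right:
  assumes S: "convex_chain S" and v: "\<And>s. s \<in> S \<Longrightarrow> fst s < fst v"
    and turn: "\<And>a b. a \<in> S - {q} \<Longrightarrow> b \<in> S - {q} \<Longrightarrow> fst a < fst b \<Longrightarrow> 0 \<le> turn a b v"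
    and ab: "q \<in> S" "a \<in> S" "b \<in> S" "fst q < fst a" "fst a < fst b"
  shows "convex_chain (insert v S)"
proof -
  have "convex_chain (insert (mirror v) (mirror ` S))"
  proof (rule convex_chain_insert_left[where q = "mirror q" and a = "mirror b" and b = "mirror a"])
    show "0 \<le> turn (mirror v) c d"
      if cd: "c \<in> mirror ` S - {mirror q}" "d \<in> mirror ` S - {mirror q}" "fst c < fst d" for c d
    proof -
      obtain c' d' where "c = mirror c'" "d = mirror d'" "c' \<in> S" "d' \<in> S" "c' \<noteq> q" "d' \<noteq> q"
        using cd(1,2) by blast
      then show ?thesis using turn[of d' c'] cd(3) by (simp add: turn_mirror)
    qed
  qed (use assms convex_chain_mirror[OF S] in auto)
  from convex_chain_mirror[OF this] show ?thesis by (simp add: image_image)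
qed

text \<open>Two new points, high above all lines through \<open>P\<close> on either side, lengthen every \<open>k\<close>-cup
  through a further point \<open>q\<close> by one: among at least four points, \<open>q\<close> is not one of the first two
  or not one of the last two, so that the first or the last segment joins points of \<open>P\<close>.\<close>
lemma semisaturated_Suc:
  assumes sat: "semisaturated k l P" and k: "4 \<le> k"
  obtains Q where "semisaturated (Suc k) l Q" "card Q = card P + 2"
proof -
  have P: "finite P" "general_position P"
    using sat by (auto simp: semisaturated_def point_set_def)
  obtain x where x: "\<And>a. a \<in> P \<Longrightarrow> x < fst a"
    using exists_left[OF P(1)] by blast
  then have "x \<notin> fst ` P" by blast
  then obtain u where u: "fst u = x" "general_position (insert u P)"
    "\<And>a b. a \<in> P \<Longrightarrow> b \<in> P \<Longrightarrow> fst a < fst b \<Longrightarrow> 0 < turn a b u"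
    using exists_high_point[OF P] by metis
  have u_left: "fst u < fst a" if "a \<in> P" for a using x u(1) that by simp
  \<comment> \<open>\<open>v\<close> is chosen relative to \<open>insert u P\<close>, so that the
    whole enlarged set is in general position.\<close>
  have fin: "finite (insert u P)" using P(1) by simp
  obtain y where y: "\<And>a. a \<in> insert u P \<Longrightarrow> fst a < y"
    using exists_right[OF fin] by blast
  then have "y \<notin> fst ` insert u P" by blast
  then obtain v where v: "fst v = y" "general_position (insert v (insert u P))"
    "\<And>a b. a \<in> insert u P \<Longrightarrow> b \<in> insert u P \<Longrightarrow> fst a < fst b \<Longrightarrow> 0 < turn a b v"
    using exists_high_point[OF fin u(2)] by metis
  have v_right: "fst a < fst v" if "a \<in> insert u P" for a using y v(1) that by simp
  let ?Q = "insert v (insert u P)"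
  have new: "u \<notin> P" "v \<notin> insert u P" using u_left v_right by blast+
  have "\<exists>S \<subseteq> ?Q \<union> {q}. q \<in> S \<and> (cup (Suc k) S \<or> cap l S)"
    if q: "q \<notin> ?Q" "general_position (?Q \<union> {q})" for q
  proof -
    have "general_position (P \<union> {q})" using q(2) by (rule general_position_subset) blast
    then have "\<exists>S \<subseteq> P \<union> {q}. q \<in> S \<and> (cup k S \<or> cap l S)"
      using sat q(1) unfolding semisaturated_def by blast
    then obtain S where S: "S \<subseteq> P \<union> {q}" "q \<in> S" "cup k S \<or> cap l S" by blast
    show ?thesis
    proof (cases "cap l S")
      case True
      then show ?thesis using S by blast
    next
      case False
      then have cup: "finite S" "card S = k" "convex_chain S" using S(3) by (auto simp: cup_iff)
      have sub: "S - {q} \<subseteq> P" using S(1) by blast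
      have notin: "u \<notin> S" "v \<notin> S" using S(1) new q(1) by blast+
      have "inj_on fst S" using cup(3) by (simp add: convex_chain_def)
      have "\<exists>w \<in> {u, v}. convex_chain (insert w S)"
        using cup(1) S(2) \<open>inj_on fst S\<close> k[folded cup(2)]
      proof (cases rule: two_on_one_side)
        case (1 a b)
        then have "a \<noteq> q" by auto
        then have "a \<in> P" using 1 sub by blast
        have "convex_chain (insert u S)"
        proof (rule convex_chain_insert_left[OF cup(3) _ _ S(2) 1])
          \<comment> \<open>\<open>q\<close> is arbitrary, but here it lies to the right of
            \<open>a\<close>, which is in \<open>P\<close> and hence to the right of
            \<open>u\<close>.\<close>
          show "fst u < fst s" if "s \<in> S" for s
            using that sub u_left[of s] u_left[OF \<open>a \<in> P\<close>] 1 by (cases "s = q") auto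
          show "0 \<le> turn u c d" if "c \<in> S - {q}" "d \<in> S - {q}" "fst c < fst d" for c d
            using u(3)[of c d] subsetD[OF sub] that turn_rotate[of u c d] by fastforce
        qed
        then show ?thesis by blast
      next
        case (2 a b)
        then have "b \<noteq> q" by auto
        then have "b \<in> insert u P" using 2 sub by blast
        have "convex_chain (insert v S)"
        proof (rule convex_chain_insert_right[OF cup(3) _ _ S(2) 2])
          show "fst s < fst v" if "s \<in> S" for s
            using that sub v_right[of s] v_right[OF \<open>b \<in> insert u P\<close>] 2 by (cases "s = q") auto
          show "0 \<le> turn c d v" if "c \<in> S - {q}" "d \<in> S - {q}" "fst c < fst d" for c d
            using v(3)[of c d] subsetD[OF sub] that by fastforce
        qed
        then show ?thesis by blast
      qed
      then obtain w where w: "w \<in> {u, v}" "convex_chain (insert w S)" by blast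
      then have "cup (Suc k) (insert w S)" using cup notin by (auto simp: cup_iff)
      then show ?thesis using w(1) S(1,2) by (intro exI[of _ "insert w S"]) blast
    qed
  qed
  then have "semisaturated (Suc k) l ?Q"
    using P(1) v(2) by (simp add: semisaturated_def point_set_def)
  moreover have "card ?Q = card P + 2" using P(1) new by simp
  ultimately show ?thesis using that by blast
qed

section \<open>A six-point set for k = l = 4\<close>

lemma cup_4I:
  assumes "fst a < fst b" "fst b < fst c" "fst c < fst d" "0 \<le> turn a b c" "0 \<le> turn b c d"
  shows "cup 4 {a, b, c, d}"
proof -
  have "a \<noteq> b" "a \<noteq> c" "a \<noteq> d" "b \<noteq> c" "b \<noteq> d" "c \<noteq> d"
    using assms by auto
  then show ?thesis
    using assms turn_trans[OF assms] by (auto simp: cup_iff convex_chain_def)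
qed

lemma cap_4I:
  assumes "fst a < fst b" "fst b < fst c" "fst c < fst d" "turn a b c \<le> 0" "turn b c d \<le> 0"
  shows "cap 4 {a, b, c, d}"
  using cup_4I[of "flip a" "flip b" "flip c" "flip d"] assms by (simp add: cap_iff)

text \<open>The set is symmetric about the origin. Each line from one of the three left points
  through \<open>?p4\<close> passes below \<open>?p5\<close> and above \<open>?p6\<close>, so
  whichever way \<open>q\<close>, a left point and \<open>?p4\<close> turn, one of these two
  continues the chain. Symmetrically, \<open>?p1\<close> and \<open>?p2\<close> serve for
  \<open>q\<close> to the right of one of the three right points.\<close>

lemma semisaturated_4_4: "\<exists>P. semisaturated 4 4 P \<and> card P = 6"
proof -
  let ?p1 = "(-3, 1) :: real \<times> real" and ?p2 = "(-2, -1) :: real \<times> real"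
    and ?p3 = "(-1, 0) :: real \<times> real" and ?p4 = "(1, 0) :: real \<times> real"
    and ?p5 = "(2, 1) :: real \<times> real" and ?p6 = "(3, -1) :: real \<times> real"
  let ?P = "{?p1, ?p2, ?p3, ?p4, ?p5, ?p6}"
  have "general_position ?P"
    by (simp add: general_position_iff turn_def)
  moreover have "\<exists>S \<subseteq> ?P \<union> {q}. q \<in> S \<and> (cup 4 S \<or> cap 4 S)"
    if q: "q \<notin> ?P" "general_position (?P \<union> {q})" for q
  proof -
    obtain x y where xy: "q = (x, y)" by fastforce
    have "inj_on fst (insert q ?P)"
      using q(2) by (simp add: general_position_def)
    then have "x \<noteq> -3" "x \<noteq> -2" "x \<noteq> -1" "x \<noteq> 1" "x \<noteq> 2" "x \<noteq> 3"
      using q(1) by (auto simp: xy)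
    then consider "x < -3" | "-3 < x" "x < -2" | "-2 < x" "x < -1" | "-1 < x" "x < 1"
      | "1 < x" "x < 2" | "2 < x" "x < 3" | "3 < x"
      by linarith
    note position = this
    have four: ?thesis
      if "{a, b, c, d} \<subseteq> ?P \<union> {q}" "q \<in> {a, b, c, d}" "fst a < fst b" "fst b < fst c" "fst c < fst d"
        "0 \<le> turn a b c \<and> 0 \<le> turn b c d \<or> turn a b c \<le> 0 \<and> turn b c d \<le> 0" for a b c d
      using that cup_4I[of a b c d] cap_4I[of a b c d] by blast
    have left: ?thesis if "i \<in> {?p1, ?p2, ?p3}" "x < fst i" for i
    proof (cases "0 \<le> turn q i ?p4")
      case True
      then show ?thesis using that by (intro four[of q i ?p4 ?p5]) (auto simp: xy turn_def)
    next
      case False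
      then show ?thesis using that by (intro four[of q i ?p4 ?p6]) (auto simp: xy turn_def)
    qed
    have right: ?thesis if "j \<in> {?p4, ?p5, ?p6}" "fst j < x" for j
    proof (cases "0 \<le> turn ?p3 j q")
      case True
      then show ?thesis using that by (intro four[of ?p1 ?p3 j q]) (auto simp: xy turn_def)
    next
      case False
      then show ?thesis using that by (intro four[of ?p2 ?p3 j q]) (auto simp: xy turn_def)
    qed
    have middle: ?thesis if "-1 < x" "x < 1"
    proof -
      \<comment> \<open>The lines \<open>?p2 ?p3\<close> and \<open>?p4 ?p5\<close> are parallel; on
        or above the first and on or below the second, the first and the last alternative hold. The
        strip between them is divided by the line \<open>?p2 ?p5\<close>: below it the second
        alternative holds, above it the third, their other inequalities being automatic
        there.\<close>
      have "0 \<le> turn ?p2 ?p3 q \<or> 0 \<le> turn ?p1 ?p2 q \<and> 0 \<le> turn ?p2 q ?p5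
        \<or> turn ?p2 q ?p5 \<le> 0 \<and> turn q ?p5 ?p6 \<le> 0 \<or> turn q ?p4 ?p5 \<le> 0"
        using that by (simp add: xy turn_def algebra_simps) (smt (verit))
      then consider "0 \<le> turn ?p2 ?p3 q" | "0 \<le> turn ?p1 ?p2 q" "0 \<le> turn ?p2 q ?p5"
        | "turn ?p2 q ?p5 \<le> 0" "turn q ?p5 ?p6 \<le> 0" | "turn q ?p4 ?p5 \<le> 0"
        by blast
      then show ?thesis
      proof cases
        case 1
        then show ?thesis using that by (intro four[of ?p1 ?p2 ?p3 q]) (auto simp: xy turn_def)
      next
        case 2
        then show ?thesis using that by (intro four[of ?p1 ?p2 q ?p5]) (auto simp: xy)
      next
        case 3
        then show ?thesis using that by (intro four[of ?p2 q ?p5 ?p6]) (auto simp: xy)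
      next
        case 4
        then show ?thesis using that by (intro four[of q ?p4 ?p5 ?p6]) (auto simp: xy turn_def)
      qed
    qed
    from position show ?thesis
      using left[of ?p1] left[of ?p2] left[of ?p3] middle right[of ?p4] right[of ?p5] right[of ?p6]
      by cases simp_all
  qed
  ultimately have "semisaturated 4 4 ?P"
    by (simp add: semisaturated_def point_set_def)
  moreover have "card ?P = 6" by simp
  ultimately show ?thesis by blast
qed

section \<open>Semisaturated sets for all k and l at least 4\<close>

lemma semisaturated_k_4:
  "4 \<le> k \<Longrightarrow> \<exists>P. semisaturated k 4 P \<and> card P = 2 * k - 2"
proof (induction k rule: dec_induct)
  case base
  then show ?case using semisaturated_4_4 by simp
next
  case (step k)
  then obtain P where P: "semisaturated k 4 P" "card P = 2 * k - 2" by blast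
  obtain Q where "semisaturated (Suc k) 4 Q" "card Q = card P + 2"
    using semisaturated_Suc[OF P(1) step(1)] by blast
  then show ?case using P(2) step(1) by (intro exI[of _ Q]) simp
qed

text \<open>\<open>semisaturated_Suc\<close> lengthens cups only, so the step in \<open>l\<close>
  applies it to the reflected set, where the \<open>l\<close>-caps have become
  \<open>l\<close>-cups.\<close>

lemma semisaturated_k_l:
  assumes "4 \<le> k"
  shows "4 \<le> l \<Longrightarrow> \<exists>P. semisaturated k l P \<and> card P = 2 * k + 2 * l - 10"
proof (induction l rule: dec_induct)
  case base
  then show ?case using semisaturated_k_4[OF assms] by simp
next
  case (step l)
  then obtain P where P: "semisaturated k l P" "card P = 2 * k + 2 * l - 10" by blast
  obtain Q where "semisaturated (Suc l) k Q" "card Q = card (flip ` P) + 2"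
    using semisaturated_Suc[OF semisaturated_flip[OF P(1)] step(1)] by blast
  then show ?case
    using P(2) step(1) assms by (intro exI[of _ "flip ` Q"]) (simp add: semisaturated_flip)
qed

section \<open>The case l = 3\<close>

lemma semisaturated_k_3:
  assumes "2 \<le> k"
  shows "\<exists>P. semisaturated k 3 P \<and> card P = k - 1"
proof -
  define f :: "nat \<Rightarrow> real \<times> real" where "f n = (real n, real n ^ 2)" for n
  define P where "P = f ` {..<k - 1}"
  have turn: "0 < turn a b c" if "a \<in> P" "b \<in> P" "c \<in> P" "fst a < fst b" "fst b < fst c" for a b c
  proof -
    \<comment> \<open>On the parabola the orientation is the Vandermonde product of the
      abscissae.\<close>
    have "turn a b c = (fst b - fst a) * (fst c - fst b) * (fst c - fst a)"
      using that(1-3) by (auto simp: P_def f_def turn_def algebra_simps power2_eq_square)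
    then show ?thesis using that by simp
  qed
  have "inj_on fst P" by (auto simp: P_def f_def inj_on_def)
  moreover have "finite P" by (simp add: P_def)
  moreover have "card P = k - 1"
    by (simp add: P_def f_def card_image inj_on_def)
  moreover have "\<exists>S \<subseteq> P \<union> {q}. q \<in> S \<and> (cup k S \<or> cap 3 S)"
    if q: "q \<notin> P" "general_position (P \<union> {q})" for q
  \<comment> \<open>Either all \<open>k\<close> points form a cup, or some triple turns right.
    Triples within \<open>P\<close> turn left, so that triple contains \<open>q\<close> and is a
    3-cap.\<close>
  proof (cases "convex_chain (P \<union> {q})")
    case True
    then have "cup k (P \<union> {q})"
      using \<open>finite P\<close> \<open>card P = k - 1\<close> q(1) assms by (simp add: cup_iff)
    then show ?thesis by blast
  next
    case False
    then obtain a b c where abc: "a \<in> P \<union> {q}" "b \<in> P \<union> {q}" "c \<in> P \<union> {q}"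
        "fst a < fst b" "fst b < fst c" "turn a b c < 0"
      using q(2) unfolding convex_chain_def general_position_def by (meson not_le)
    then have "q \<in> {a, b, c}"
      using turn[of a b c] by auto
    moreover have "cap 3 {a, b, c}"
    proof -
      have "a \<noteq> b" "a \<noteq> c" "b \<noteq> c" using abc by auto
      then have "card (flip ` {a, b, c}) = 3" unfolding card_flip by simp
      moreover have "convex_chain (flip ` {a, b, c})"
        using abc by (auto simp: convex_chain_def)
      ultimately show ?thesis unfolding cap_iff cup_iff by blast
    qed
    ultimately show ?thesis using abc(1-3) by (intro exI[of _ "{a, b, c}"]) simp
  qed
  moreover have "general_position P"
    using \<open>inj_on fst P\<close> turn by (force simp: general_position_iff)
  ultimately show ?thesis
    by (auto simp: semisaturated_def point_set_def)
qed

text \<open>A point high to the right of \<open>P\<close> would be the last point of a 3-cap through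
  it, yet it lies above the line through the other two. So it lies in a \<open>k\<close>-cup, whose
  other points belong to \<open>P\<close>.\<close>

lemma semisaturated_3_card_ge:
  assumes sat: "semisaturated k 3 P"
  shows "k - 1 \<le> card P"
proof -
  have P: "finite P" "general_position P"
    using sat by (auto simp: semisaturated_def point_set_def)
  obtain x where x: "\<And>a. a \<in> P \<Longrightarrow> fst a < x"
    using exists_right[OF P(1)] by blast
  then have "x \<notin> fst ` P" by blast
  then obtain q where q: "fst q = x" "general_position (insert q P)"
    "\<And>a b. a \<in> P \<Longrightarrow> b \<in> P \<Longrightarrow> fst a < fst b \<Longrightarrow> 0 < turn a b q"
    using exists_high_point[OF P] by metis
  have "q \<notin> P" using x[of q] q(1) by auto
  moreover have "general_position (P \<union> {q})" using q(2) by simp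
  ultimately obtain S where S: "S \<subseteq> P \<union> {q}" "q \<in> S" "cup k S \<or> cap 3 S"
    using sat unfolding semisaturated_def by blast
  have "\<not> cap 3 S"
  proof
    assume "cap 3 S"
    then have "card S = 3" "convex_chain (flip ` S)" by (auto simp: cap_iff cup_iff)
    moreover from this have "3 \<le> card S" "inj_on fst S" by (simp_all add: convex_chain_def)
    then obtain a b c where abc: "a \<in> S" "b \<in> S" "c \<in> S" "fst a < fst b" "fst b < fst c"
      by (rule three_in_order)
    have "finite S" using S(1) P(1) finite_subset by blast
    moreover have "a \<noteq> b" "b \<noteq> c" "a \<noteq> c" using abc by auto
    then have "card {a, b, c} = 3" by simp
    ultimately have "S = {a, b, c}"
      using abc by (intro card_subset_eq[symmetric]) auto
    moreover have "a \<noteq> q" "b \<noteq> q" using x[of b] x[of c] S(1) abc q(1) by auto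
    ultimately have "c = q" using S(2) by auto
    then have "0 < turn a b c" using q(3)[of a b] abc S(1) \<open>a \<noteq> q\<close> \<open>b \<noteq> q\<close> by auto
    then show False
      using convex_chain_flipD[OF \<open>convex_chain (flip ` S)\<close>, of a b c] abc by simp
  qed
  then have "k = card S" using S(3) by (simp add: cup_iff)
  also have "\<dots> \<le> card (insert q P)" using S(1) P(1) by (intro card_mono) auto
  also have "\<dots> \<le> Suc (card P)" by (simp add: card_insert_if P(1))
  finally show ?thesis by simp
qed

theorem theorem7:
  shows "(\<forall>k::nat. k \<ge> 2 \<longrightarrow> osat k 3 = enat (k - 1) \<and> osat 3 k = enat (k - 1)) \<and>
         (\<forall>k::nat. k \<ge> 4 \<longrightarrow> osat k 4 = enat (2 * k - 2) \<and> osat 4 k = enat (2 * k - 2)) \<and>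
         (\<forall>k l::nat. k \<ge> 5 \<and> l \<ge> 5 \<longrightarrow>
            enat (2 * k + 2 * l - 12) \<le> osat k l \<and> osat k l \<le> enat (2 * k + 2 * l - 10))"
proof (intro conjI allI impI)
  fix k :: nat assume "2 \<le> k"
  then show "osat k 3 = enat (k - 1)"
    using semisaturated_k_3 semisaturated_3_card_ge by (simp add: osat_eq_enat_iff)
  then show "osat 3 k = enat (k - 1)" by (simp add: osat_commute)
next
  fix k :: nat assume "4 \<le> k"
  then show "osat k 4 = enat (2 * k - 2)"
    using semisaturated_k_4 semisaturated_card_ge(2)[of k 4] by (simp add: osat_eq_enat_iff)
  then show "osat 4 k = enat (2 * k - 2)" by (simp add: osat_commute)
next
  fix k l :: nat assume "5 \<le> k \<and> 5 \<le> l"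
  then have kl: "4 \<le> k" "4 \<le> l" by simp_all
  show "enat (2 * k + 2 * l - 12) \<le> osat k l"
    unfolding osat_def using semisaturated_card_ge(1)[OF _ kl] by (auto intro: INF_greatest)
  obtain P where "semisaturated k l P" "card P = 2 * k + 2 * l - 10"
    using semisaturated_k_l[OF kl] by blast
  then show "osat k l \<le> enat (2 * k + 2 * l - 10)"
    unfolding osat_def by (auto intro: INF_lower2)
qed

end
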